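(* Let $q$ be a power of a prime, let $n\ge 3$ and $s\ge 1$ be integers with $\gcd(s,n)=1$, and put $\sigma=q^s$. Let $f(x)=\sum_{i=1}^{n-1}a_ix^{\sigma^i}$ with $a_1,\ldots,a_{n-1}\in\mathbb F_{q^n}$. For $x\in\mathbb F_{q^n}$ let $$g_x(t)=-f(x)\,t+\sum_{i=1}^{n-1}a_ix^{\sigma^i}t^{\sigma^i}=-f(x)t+f(xt),$$ regarded as a linearized polynomial in $t$ over $\mathbb F_{q^n}$, and let $M_{\sigma,g_x}$ be its $\sigma$-matrix of Dickson. Then the following conditions are equivalent: (i) the polynomial $f(x)$ is scattered; (ii) for any $x\in\mathbb F_{q^n}^*$, there exists a nonsingular $(n-1)\times(n-1)$ submatrix of $M_{\sigma,g_x}$ (obtained by deleting one row and one column); (iii) for any $x\in\mathbb F_{q^n}^*$, all $(n-1)\times(n-1)$ submatrices of $M_{\sigma,g_x}$ (obtained by deleting one row and one column) are nonsingular.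
   Context: $\mathbb F_{q^n}$ is the finite field with $q^n$ elements and $\mathbb F_{q^n}^*=\mathbb F_{q^n}\setminus\{0\}$. A linearized polynomial $f$ over $\mathbb F_{q^n}$ (an $\mathbb F_q$-linear map $\mathbb F_{q^n}\to\mathbb F_{q^n}$) is called scattered if for any $t,x\in\mathbb F_{q^n}$ the condition $xf(t)-tf(x)=0$ holds if and only if $x$ and $t$ are $\mathbb F_q$-linearly dependent. The $\sigma$-matrix of Dickson associated with a linearized polynomial $g(t)=\sum_{i=0}^{n-1}c_it^{\sigma^i}$, $c_i\in\mathbb F_{q^n}$, is the $n\times n$ matrix $M_{\sigma,g}$ whose entry in row $r$ and column $k$ ($r,k\in\{0,1,\ldots,n-1\}$) is $c_{k-r}^{\sigma^r}$, where the index $k-r$ is taken modulo $n$ in $\{0,\ldots,n-1\}$. In particular its first row is $(c_0,c_1,\ldots,c_{n-1})$ and its second row is $(c_{n-1}^\sigma,c_0^\sigma,\ldots,c_{n-2}^\sigma)$. *)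

theory Defs
  imports
    "HOL-Computational_Algebra.Polynomial"
    "HOL-Number_Theory.Prime_Powers"
    "HOL-Algebra.Algebraic_Closure_Type"
    "Jordan_Normal_Form.Determinant"
begin

hide_const (open) UnivPoly.monom UnivPoly.coeff

text \<open>Linear dependence of the \<^emph>\<open>family\<close> \<open>(x, t)\<close> over the subfield \<open>K\<close>;
  in particular \<open>(x, x)\<close> is always dependent, even though the set \<open>{x, x}\<close> need not be.\<close>

definition lin_dependent2 :: "'a::field set \<Rightarrow> 'a \<Rightarrow> 'a \<Rightarrow> bool" where
  "lin_dependent2 K x t \<longleftrightarrow>
     (\<exists>\<alpha>\<in>K. \<exists>\<beta>\<in>K. (\<alpha> \<noteq> 0 \<or> \<beta> \<noteq> 0) \<and> \<alpha> * x + \<beta> * t = 0)"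

text \<open>Scatteredness over \<open>K\<close>, meant for polynomials inducing a \<open>K\<close>-linear map.\<close>

definition scattered :: "'a::field set \<Rightarrow> 'a poly \<Rightarrow> bool" where
  "scattered K f \<longleftrightarrow>
     (\<forall>t x. x * poly f t - t * poly f x = 0 \<longleftrightarrow> lin_dependent2 K x t)"

text \<open>Since \<open>r < n\<close>, the index \<open>(k + n - r) mod n\<close> is \<open>k - r\<close> reduced
  modulo \<open>n\<close>; the \<open>n\<close> is added first only to avoid truncated subtraction.
  The \<open>i\<close>-th coefficient of the linearized polynomial \<open>g\<close> is the coefficient
  of \<open>t ^ (\<sigma> ^ i)\<close>.\<close>

definition dickson_mat :: "nat \<Rightarrow> nat \<Rightarrow> 'a::field poly \<Rightarrow> 'a mat" where
  "dickson_mat \<sigma> n g =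
     mat n n (\<lambda>(r, k). coeff g (\<sigma> ^ ((k + n - r) mod n)) ^ (\<sigma> ^ r))"

lemma poly_g_eq:
  fixes a :: "nat \<Rightarrow> 'a::field"
  assumes "f = (\<Sum>i=1..n-1. monom (a i) (\<sigma> ^ i))"
    and "g = monom (- poly f x) 1 + (\<Sum>i=1..n-1. monom (a i * x ^ (\<sigma> ^ i)) (\<sigma> ^ i))"
  shows "poly g t = - poly f x * t + poly f (x * t)"
  by (simp add: assms poly_sum poly_monom power_mult_distrib mult.assoc)

end

theory Submission
  imports Defs "HOL-Number_Theory.Residues"
begin

text \<open>
  The condition \<open>x f(t) = t f(x)\<close> with \<open>x \<noteq> 0\<close> and \<open>t = x u\<close> reads \<open>g\<^sub>x(u) = 0\<close>, and \<open>x\<close>,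
  \<open>x u\<close> are dependent over \<open>K\<close> iff \<open>u \<in> K\<close>.  Since \<open>g\<^sub>x\<close> always vanishes on \<open>K\<close>, scatteredness
  says that no \<open>g\<^sub>x\<close> with \<open>x \<noteq> 0\<close> has a zero outside \<open>K\<close>.  As \<open>s\<close> is prime to \<open>n\<close>, \<open>K\<close> is the
  set of fixed points of \<open>u \<mapsto> u\<^sup>\<sigma>\<close>.  Both equivalences therefore follow from a dichotomy for a
  single linearized polynomial \<open>c\<close> with \<open>c(1) = 0\<close> and Dickson matrix \<open>M\<close>: if \<open>c\<close> has a zero
  outside \<open>K\<close>, all \<open>(n-1) \<times> (n-1)\<close> minors of \<open>M\<close> vanish; otherwise none of them does.
  The minor for row \<open>r\<close> and column \<open>k\<close> vanishes iff there is a vector \<open>w \<noteq> 0\<close> with \<open>w\<^sub>k = 0\<close> such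
  that \<open>M w\<close> is zero off position \<open>r\<close> (\<open>det_mat_delete_eq_0_iff\<close>).

  For a zero \<open>t\<close> of \<open>c\<close>, the vector of all \<open>t\<close> to the power \<open>\<sigma>\<^sup>j\<close> lies in the kernel of \<open>M\<close>.  If
  \<open>t \<notin> K\<close>, it is not constant, so subtracting a multiple of the kernel vector \<open>(1, \<dots>, 1)\<close> puts a
  zero at any desired position \<open>k\<close> (\<open>singular_minor_if_kernel\<close>).

  For the converse, \<open>M\<close> is read as left composition with \<open>c\<close>: a vector \<open>w\<close> encodes the map
  \<open>H\<^sub>w(\<alpha>) = \<Sum>\<^sub>k \<sigma>\<^sup>-\<^sup>k(w\<^sub>k \<alpha>)\<close>, where \<open>\<sigma>\<close> stands for the automorphism, and \<open>c \<circ> H\<^sub>w = H\<^bsub>M w\<^esub>\<close>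
  (\<open>linearized_vec_map\<close>).  Let \<open>w\<close> witness a vanishing minor.  If \<open>M w\<close> were not zero, \<open>H\<^bsub>M w\<^esub>\<close>
  would have a single summand and be bijective, hence \<open>c\<close> would be surjective on a finite set and so
  injective, contrary to \<open>c(0) = c(1)\<close>.  So \<open>c \<circ> H\<^sub>w = 0\<close>, and if all zeros of \<open>c\<close> lie in \<open>K\<close> then
  \<open>H\<^sub>w\<close> is unchanged by applying \<open>\<sigma>\<close>.  Applying \<open>\<sigma>\<close> shifts \<open>w\<close> cyclically, and \<open>w\<close> is determined
  by \<open>H\<^sub>w\<close> because distinct automorphisms are independent; so \<open>w\<close> is constant, which contradicts
  \<open>w\<^sub>k = 0\<close> and \<open>w \<noteq> 0\<close> (\<open>nonsingular_minor_if_kernel_fixed\<close>).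
\<close>

hide_const (open) UnivPoly.monom UnivPoly.coeff


section \<open>Singular minors\<close>

lemma sum_insert_index:
  fixes F :: "nat \<Rightarrow> 'a::comm_monoid_add"
  assumes "k < n" and "F k = 0"
  shows "(\<Sum>j<n. F j) = (\<Sum>j<n - 1. F (insert_index k j))"
proof -
  obtain m where n: "n = Suc m"
    using assms(1) by (cases n) auto
  have "(\<Sum>j<n. F j) = (\<Sum>j\<in>{0..<Suc m} - {k}. F j)"
    using assms by (intro sum.mono_neutral_right) (auto simp: n)
  also have "{0..<Suc m} - {k} = insert_index k ` {0..<m}"
    using assms(1) by (simp add: insert_index_image n)
  also have "sum F \<dots> = (\<Sum>j\<in>{0..<m}. F (insert_index k j))"
    by (simp add: sum.reindex[OF insert_index_inj_on])
  finally show ?thesis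
    by (simp add: n atLeast0LessThan)
qed

lemma insert_index_less: "k < n \<Longrightarrow> j < n - 1 \<Longrightarrow> insert_index k j < n"
  by (auto simp: insert_index_def)

text \<open>
  A kernel vector of the submatrix, extended by \<open>0\<close> at the deleted column, is a vector that all
  remaining rows of \<open>A\<close> annihilate.  In this form the row and column deletions leave the cyclic
  indexing of a Dickson matrix intact.
\<close>

lemma det_mat_delete_eq_0_iff:
  fixes A :: "'a::field mat"
  assumes A: "A \<in> carrier_mat n n" and r: "r < n" and k: "k < n"
  shows "det (mat_delete A r k) = 0 \<longleftrightarrow>
    (\<exists>w. w k = 0 \<and> (\<exists>j<n. w j \<noteq> 0) \<and> (\<forall>i<n. i \<noteq> r \<longrightarrow> (\<Sum>j<n. A $$ (i, j) * w j) = 0))"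
    (is "?L \<longleftrightarrow> ?R")
proof -
  obtain m where n: "n = Suc m"
    using r by (cases n) auto
  define B where "B = mat_delete A r k"
  have B: "B \<in> carrier_mat m m"
    using mat_delete_carrier[OF A, of r k] by (simp add: n B_def)
  have entry: "B $$ (i, j) = A $$ (insert_index r i, insert_index k j)" if "i < m" "j < m" for i j
    using mat_delete_index[of A m r k i j] A r k that by (simp add: n B_def)
  have row: "(B *\<^sub>v v) $ i = (\<Sum>j<n. A $$ (insert_index r i, j) * w j)"
    if "i < m" "w k = 0" "v \<in> carrier_vec m" "\<And>j. j < m \<Longrightarrow> w (insert_index k j) = v $ j" for v :: "'a vec" and w i
  proof -
    have "(B *\<^sub>v v) $ i = (\<Sum>j<m. B $$ (i, j) * v $ j)"
      using carrier_matD[OF B] carrier_vecD[OF that(3)] that(1)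
      by (simp add: scalar_prod_def atLeast0LessThan)
    also have "\<dots> = (\<Sum>j<n. A $$ (insert_index r i, j) * w j)"
      by (subst sum_insert_index[OF k]) (use that entry in \<open>auto simp: n\<close>)
    finally show ?thesis .
  qed
  have "?L \<longleftrightarrow> (\<exists>v. v \<in> carrier_vec m \<and> v \<noteq> 0\<^sub>v m \<and> B *\<^sub>v v = 0\<^sub>v m)"
    unfolding B_def[symmetric] by (rule det_0_iff_vec_prod_zero_field[OF B])
  also have "\<dots> \<longleftrightarrow> ?R"
  proof
    assume "\<exists>v. v \<in> carrier_vec m \<and> v \<noteq> 0\<^sub>v m \<and> B *\<^sub>v v = 0\<^sub>v m"
    then obtain v where v: "v \<in> carrier_vec m" "v \<noteq> 0\<^sub>v m" "B *\<^sub>v v = 0\<^sub>v m"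
      by blast
    define w where "w j = (if j = k then 0 else v $ delete_index k j)" for j
    have w: "w (insert_index k j) = v $ j" for j
      by (simp add: w_def)
    obtain j where "j < m" "v $ j \<noteq> 0"
      using v(1,2) by (metis carrier_vecD eq_vecI index_zero_vec(1,2))
    then have "\<exists>j<n. w j \<noteq> 0"
      using w[of j] insert_index_less[OF k, of j] by (metis diff_Suc_1 n)
    moreover have "(\<Sum>j<n. A $$ (i, j) * w j) = 0" if i: "i < n" "i \<noteq> r" for i
    proof -
      have "i \<in> insert_index r ` {0..<m}"
        using i r by (simp add: insert_index_image n)
      then obtain i' where i': "i' < m" "i = insert_index r i'"
        by auto
      have "(\<Sum>j<n. A $$ (i, j) * w j) = (B *\<^sub>v v) $ i'"
        unfolding i'(2) by (rule row[symmetric]) (use i' v w in \<open>auto simp: w_def\<close>)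
      then show ?thesis
        using v i' by simp
    qed
    ultimately show ?R
      by (intro exI[of _ w]) (auto simp: w_def)
  next
    assume ?R
    then obtain w l where w: "w k = 0" "l < n" "w l \<noteq> 0"
      "\<And>i. i < n \<Longrightarrow> i \<noteq> r \<Longrightarrow> (\<Sum>j<n. A $$ (i, j) * w j) = 0"
      by blast
    define v where "v = vec m (\<lambda>j. w (insert_index k j))"
    have v: "v \<in> carrier_vec m"
      by (simp add: v_def)
    have "l \<in> insert_index k ` {0..<m}"
      using w(1-3) k by (auto simp add: insert_index_image n)
    then obtain j where j: "j < m" "l = insert_index k j"
      by auto
    then have "v $ j \<noteq> 0"
      using w(3) by (simp add: v_def)
    then have "v \<noteq> 0\<^sub>v m"
      using j by auto
    moreover have "B *\<^sub>v v = 0\<^sub>v m"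
    proof (rule eq_vecI)
      fix i assume "i < dim_vec (0\<^sub>v m :: 'a vec)"
      then have i: "i < m" by simp
      have "(B *\<^sub>v v) $ i = (\<Sum>j<n. A $$ (insert_index r i, j) * w j)"
        by (rule row) (use i w(1) in \<open>auto simp: v_def\<close>)
      also have "\<dots> = 0"
        by (rule w(4)) (use i insert_index_less[OF r, of i] n in auto)
      finally show "(B *\<^sub>v v) $ i = 0\<^sub>v m $ i"
        using i by simp
    qed (use B in auto)
    ultimately show "\<exists>v. v \<in> carrier_vec m \<and> v \<noteq> 0\<^sub>v m \<and> B *\<^sub>v v = 0\<^sub>v m"
      using v by blast
  qed
  finally show ?thesis .
qed


section \<open>A generator of the Galois group of a finite field\<close>

lemma uminus_closed_if_subring:
  fixes K :: "'a::comm_ring_1 set"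
  assumes "subring K (ring_of_type_algebra :: 'a ring)" "z \<in> K"
  shows "- z \<in> K"
proof -
  interpret R: ring "ring_of_type_algebra :: 'a ring"
    by (rule ring_from_type_algebra)
  have "\<ominus>\<^bsub>ring_of_type_algebra\<^esub> z = - z"
    by (rule R.minus_equality) (simp_all add: ring_of_type_algebra_def)
  then show ?thesis
    using subringE(5)[OF assms] by simp
qed

text \<open>
  Multiplication by a nonzero element permutes the nonzero elements of \<open>K\<close>, which gives one
  inclusion; the polynomial \<open>X\<^sup>|\<^sup>K\<^sup>| - X\<close> has no room for further roots.
\<close>

lemma subfield_eq_power_fixpoints:
  fixes K :: "'a::finite_field set"
  assumes K: "subfield K (ring_of_type_algebra :: 'a ring)"
  shows "K = {x. x ^ card K = x}"
proof -
  have "subring K (ring_of_type_algebra :: 'a ring)"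
    using K by (simp add: subfield.axioms subdomain.axioms subcring.axioms)
  note sub = subringE[OF this, unfolded ring_of_type_algebra_def, simplified]
  have pos: "card K > 1"
  proof -
    have "card {0, 1 :: 'a} \<le> card K"
      by (rule card_mono) (use sub in auto)
    then show ?thesis by simp
  qed
  have "x ^ card K = x" if x: "x \<in> K" for x
  proof (cases "x = 0")
    case False
    have inj: "inj_on ((*) x) (K - {0})"
      using False by (auto intro: inj_onI)
    have "(*) x ` (K - {0}) = K - {0}"
      by (rule endo_inj_surj) (use inj False x sub in auto)
    then have "bij_betw ((*) x) (K - {0}) (K - {0})"
      using inj by (simp add: bij_betw_def)
    then have "(\<Prod>y\<in>K - {0}. x * y) = (\<Prod>y\<in>K - {0}. y)"
      by (rule prod.reindex_bij_betw)
    then have "x ^ (card K - 1) * (\<Prod>y\<in>K - {0}. y) = (\<Prod>y\<in>K - {0}. y)"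
      using sub by (simp add: prod.distrib)
    then have "x ^ (card K - 1) = 1"
      by simp
    then show ?thesis
      using power_minus_mult[of "card K" x] pos by simp
  qed (use pos in auto)
  moreover have "card {x :: 'a. x ^ card K = x} \<le> card K"
  proof -
    let ?p = "monom 1 (card K) - monom 1 1 :: 'a poly"
    have "coeff ?p (card K) \<noteq> 0"
      using pos by simp
    then have "?p \<noteq> 0"
      by (metis coeff_0)
    then have "card {x. poly ?p x = 0} \<le> degree ?p"
      by (rule card_poly_roots_bound)
    also have "\<dots> \<le> card K"
      using pos by (intro degree_diff_le) (auto simp: degree_monom_eq)
    finally show ?thesis
      by (simp add: poly_monom)
  qed
  ultimately show ?thesis
    by (intro card_seteq) auto
qed

text \<open>
  Because \<open>s\<close> is prime to \<open>n\<close>, the map \<open>x \<mapsto> x\<^sup>\<sigma>\<close> generates the cyclic group of order \<open>n\<close> of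
  automorphisms of the field over its subfield of \<open>q\<close> elements.  The parameter \<open>ty\<close> ties the
  numbers to the type of the field.
\<close>

locale frobenius_generator =
  fixes q n s \<sigma> :: nat and ty :: "'a::finite_field itself"
  assumes primepow_q: "primepow q"
    and n_pos: "0 < n"
    and coprime_s_n: "gcd s n = 1"
    and \<sigma>_eq: "\<sigma> = q ^ s"
    and card_UNIV_eq: "card (UNIV :: 'a set) = q ^ n"
begin

lemma q_gt_1: "1 < q"
  using primepow_q primepow_gt_Suc_0 by auto

lemma prime_CHAR: "Factorial_Ring.prime (CHAR('a))"
  by (rule prime_CHAR_semidom) (simp add: finite_imp_CHAR_pos)

lemma \<sigma>_power_is_CHAR_power: "\<exists>e. \<sigma> ^ m = CHAR('a) ^ e"
proof -
  obtain p e where p: "Factorial_Ring.prime p" "q = p ^ e"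
    using primepow_q by (auto simp: primepow_def)
  have "CHAR('a) dvd p ^ (e * n)"
    using CHAR_dvd_CARD[where ?'a = 'a] by (simp add: card_UNIV_eq p power_mult)
  then have "CHAR('a) = p"
    using p(1) prime_CHAR prime_dvd_power primes_dvd_imp_eq by blast
  then have "\<sigma> ^ m = CHAR('a) ^ (e * s * m)"
    by (simp add: \<sigma>_eq p power_mult)
  then show ?thesis ..
qed

lemma sum_power_\<sigma>: "(\<Sum>i\<in>A. h i) ^ \<sigma> ^ m = (\<Sum>i\<in>A. (h i :: 'a) ^ \<sigma> ^ m)"
  using \<sigma>_power_is_CHAR_power[of m] freshmans_dream_sum'[OF prime_CHAR] by blast

lemma add_power_\<sigma>: "(x + y :: 'a) ^ \<sigma> ^ m = x ^ \<sigma> ^ m + y ^ \<sigma> ^ m"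
  using \<sigma>_power_is_CHAR_power[of m] freshmans_dream'[OF prime_CHAR] by blast

lemma \<sigma>_pos: "0 < \<sigma>"
  using q_gt_1 by (simp add: \<sigma>_eq)

lemma diff_power_\<sigma>: "(x - y :: 'a) ^ \<sigma> ^ m = x ^ \<sigma> ^ m - y ^ \<sigma> ^ m"
  using add_power_\<sigma>[of "x - y" y m] by simp

lemma power_\<sigma>_power_\<sigma>: "(x ^ \<sigma> ^ i) ^ \<sigma> ^ j = (x :: 'a) ^ \<sigma> ^ (i + j)"
  by (simp add: power_add flip: power_mult)

lemma power_q_cong:
  assumes "[i = j] (mod n)"
  shows "(x :: 'a) ^ q ^ i = x ^ q ^ j"
proof -
  have "x ^ q ^ i = x ^ q ^ (i mod n)" for i
  proof -
    have "q ^ i = (q ^ n) ^ (i div n) * q ^ (i mod n)"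
      by (simp flip: power_mult power_add)
    then have "x ^ q ^ i = (x ^ (q ^ n) ^ (i div n)) ^ q ^ (i mod n)"
      by (simp add: power_mult)
    also have "x ^ (q ^ n) ^ (i div n) = x"
      by (rule finite_field_power_card_power_eq_same) (simp add: card_UNIV_eq)
    finally show ?thesis .
  qed
  then show ?thesis
    using assms by (metis cong_def)
qed

lemma power_\<sigma>_cong:
  assumes "[i = j] (mod n)"
  shows "(x :: 'a) ^ \<sigma> ^ i = x ^ \<sigma> ^ j"
  using power_q_cong[of "s * i" "s * j" x] assms
  by (simp add: \<sigma>_eq cong_scalar_left flip: power_mult)

lemma power_\<sigma>_n: "(x :: 'a) ^ \<sigma> ^ n = x"
  using power_\<sigma>_cong[of n 0 x] by (simp add: cong_def)

text \<open>
  From right to left iterate; from left to right choose \<open>m\<close> with \<open>s m \<equiv> 1\<close> modulo \<open>n\<close>, so that the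
  \<open>m\<close>-fold iterate of \<open>x \<mapsto> x\<^sup>\<sigma>\<close> is \<open>x \<mapsto> x\<^sup>q\<close>.
\<close>

lemma power_\<sigma>_fixpoint_iff: "(x :: 'a) ^ \<sigma> = x \<longleftrightarrow> x ^ q = x"
proof
  assume "x ^ q = x"
  then have "x ^ q ^ m = x" for m
    by (induction m) (simp_all add: power_mult)
  then show "x ^ \<sigma> = x"
    by (simp add: \<sigma>_eq)
next
  assume "x ^ \<sigma> = x"
  then have *: "x ^ \<sigma> ^ m = x" for m
    by (induction m) (simp_all add: power_mult)
  obtain m where m: "[s * m = 1] (mod n)"
    using coprime_s_n by (metis cong_solve_nat)
  have "x ^ q = x ^ q ^ (s * m)"
    using power_q_cong[OF m, of x] by simp
  also have "\<dots> = x"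
    using *[of m] by (simp add: \<sigma>_eq power_mult)
  finally show "x ^ q = x" .
qed

text \<open>
  Linear independence of the automorphisms.  Reducing the exponents \<open>s (n - k)\<close> modulo \<open>n\<close> turns the
  sum into a polynomial of degree less than \<open>q\<^sup>n\<close> that vanishes on all \<open>q\<^sup>n\<close> elements of the field,
  and the reduced exponents are distinct because \<open>s\<close> is prime to \<open>n\<close>.
\<close>

lemma powers_\<sigma>_independent:
  assumes zero: "\<And>x :: 'a. (\<Sum>k<n. d k * x ^ \<sigma> ^ (n - k)) = 0" and k: "k < n"
  shows "d k = 0"
proof -
  define e where "e k = s * (n - k) mod n" for k
  have e_less: "e k < n" for k
    using n_pos by (simp add: e_def)
  have inj: "inj_on e {..<n}"
  proof (rule inj_onI)
    fix i j assume ij: "i \<in> {..<n}" "j \<in> {..<n}" "e i = e j"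
    then have "[n - i = n - j] (mod n)"
      using coprime_s_n by (auto simp: e_def cong_def[symmetric] coprime_iff_gcd_eq_1 cong_mult_lcancel_nat)
    then have "[n - i + (i + j) = n - j + (i + j)] (mod n)"
      by (rule cong_add) simp
    moreover have "n - i + (i + j) = n + j" "n - j + (i + j) = n + i"
      using ij by auto
    ultimately show "i = j"
      using ij by (simp add: cong_def)
  qed
  define p where "p = (\<Sum>k<n. monom (d k) (q ^ e k))"
  have "poly p x = 0" for x
  proof -
    have "x ^ \<sigma> ^ (n - k) = x ^ q ^ e k" for k
      using power_q_cong[of "s * (n - k)" "e k" x]
      by (simp add: e_def \<sigma>_eq cong_def flip: power_mult)
    then show ?thesis
      using zero[of x] by (simp add: p_def poly_sum poly_monom)
  qed
  moreover have "degree p < card (UNIV :: 'a set)"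
  proof -
    have "degree p \<le> q ^ (n - 1)"
      unfolding p_def
    proof (rule degree_sum_le)
      fix k
      show "degree (monom (d k) (q ^ e k)) \<le> q ^ (n - 1)"
        using e_less[of k] q_gt_1
        by (intro order_trans[OF degree_monom_le] power_increasing) auto
    qed simp
    also have "\<dots> < q ^ n"
      using q_gt_1 n_pos by (intro power_strict_increasing) auto
    finally show ?thesis
      by (simp add: card_UNIV_eq)
  qed
  ultimately have "p = 0"
    using card_poly_roots_bound[of p] by fastforce
  then have "0 = coeff p (q ^ e k)"
    by simp
  also have "\<dots> = (\<Sum>i<n. if i = k then d i else 0)"
    unfolding p_def coeff_sum
    by (rule sum.cong) (use inj k q_gt_1 in \<open>auto simp: inj_on_def\<close>)
  also have "\<dots> = d k"
    using k by simp
  finally show ?thesis by simp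
qed


section \<open>The Dickson matrix as composition of linearized polynomials\<close>

definition linearized :: "(nat \<Rightarrow> 'a) \<Rightarrow> 'a \<Rightarrow> 'a" where
  "linearized c t = (\<Sum>i<n. c i * t ^ \<sigma> ^ i)"

definition dickson_entry :: "(nat \<Rightarrow> 'a) \<Rightarrow> nat \<Rightarrow> nat \<Rightarrow> 'a" where
  "dickson_entry c r k = c ((k + n - r) mod n) ^ \<sigma> ^ r"

text \<open>
  The exponent \<open>n - k\<close> plays the role of \<open>-k\<close>.  With inverse powers of the automorphism, the twist
  by \<open>\<sigma>\<^sup>r\<close> in row \<open>r\<close> of the Dickson matrix is undone, so that the matrix acts on the vectors \<open>w\<close> by
  composition of maps.
\<close>

definition vec_map :: "(nat \<Rightarrow> 'a) \<Rightarrow> 'a \<Rightarrow> 'a" where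
  "vec_map w \<alpha> = (\<Sum>k<n. (w k * \<alpha>) ^ \<sigma> ^ (n - k))"

lemma shift_mod:
  assumes "k < n" "r < n"
  shows "(k + n - r) mod n = (if r \<le> k then k - r else k + n - r)"
proof (cases "r \<le> k")
  case True
  then have "(k + n - r) mod n = (k - r + n) mod n" by simp
  also have "\<dots> = (k - r) mod n" by (rule mod_add_self2)
  finally show ?thesis using True assms by simp
qed (use assms in simp)

text \<open>
  Row \<open>r\<close> of the Dickson matrix is the cyclically shifted first row with \<open>\<sigma>\<^sup>r\<close> applied, and applying
  \<open>\<sigma>\<^sup>r\<close> to the power vector of \<open>t\<close> shifts it in the same way.
\<close>

lemma dickson_row_on_power_vector:
  assumes r: "r < n"
  shows "(\<Sum>k<n. dickson_entry c r k * t ^ \<sigma> ^ k) = linearized c t ^ \<sigma> ^ r"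
proof -
  have "linearized c t ^ \<sigma> ^ r = (\<Sum>i<n. c i ^ \<sigma> ^ r * t ^ \<sigma> ^ (i + r))"
    unfolding linearized_def sum_power_\<sigma>
    by (simp add: power_mult_distrib power_\<sigma>_power_\<sigma>)
  also have "\<dots> = (\<Sum>k<n. dickson_entry c r k * t ^ \<sigma> ^ k)"
  proof (rule sum.reindex_bij_witness[of _ "\<lambda>k. (k + n - r) mod n" "\<lambda>i. (i + r) mod n"])
    fix i assume i: "i \<in> {..<n}"
    show unshift: "((i + r) mod n + n - r) mod n = i"
    proof (cases "i + r < n")
      case True
      then have "(i + r) mod n + n - r = i + n" by simp
      then show ?thesis using i by simp
    next
      case False
      then have "(i + r) mod n = i + r - n"
        using i r by (simp add: le_mod_geq)
      then have "(i + r) mod n + n - r = i"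
        using False by simp
      then show ?thesis using i by simp
    qed
    show "dickson_entry c r ((i + r) mod n) * t ^ \<sigma> ^ ((i + r) mod n) = c i ^ \<sigma> ^ r * t ^ \<sigma> ^ (i + r)"
      using power_\<sigma>_cong[of "(i + r) mod n" "i + r" t] by (simp add: dickson_entry_def unshift cong_def)
  next
    fix k assume k: "k \<in> {..<n}"
    show "((k + n - r) mod n + r) mod n = k"
      using k r by (simp add: mod_add_left_eq)
  qed (use n_pos in auto)
  finally show ?thesis ..
qed

text \<open>
  The Dickson matrix is the matrix of left composition with the linearized polynomial:
  \<open>c\<^sub>i \<sigma>\<^sup>i(\<sigma>\<^sup>-\<^sup>k(w\<^sub>k \<alpha>))\<close> is the term \<open>\<sigma>\<^sup>-\<^sup>r(\<sigma>\<^sup>r(c\<^sub>i) w\<^sub>k \<alpha>)\<close> for \<open>r = k - i\<close>, with \<open>\<sigma>\<close> denoting the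
  automorphism.
\<close>

lemma linearized_vec_map:
  "linearized c (vec_map w \<alpha>) = vec_map (\<lambda>r. \<Sum>k<n. dickson_entry c r k * w k) \<alpha>"
proof -
  have "linearized c (vec_map w \<alpha>) = (\<Sum>i<n. \<Sum>k<n. c i * (w k * \<alpha>) ^ \<sigma> ^ (n - k + i))"
    by (simp add: linearized_def vec_map_def sum_power_\<sigma> power_\<sigma>_power_\<sigma> sum_distrib_left)
  also have "\<dots> = (\<Sum>k<n. \<Sum>i<n. c i * (w k * \<alpha>) ^ \<sigma> ^ (n - k + i))"
    by (rule sum.swap)
  also have "\<dots> = (\<Sum>k<n. \<Sum>r<n. (dickson_entry c r k * w k * \<alpha>) ^ \<sigma> ^ (n - r))"
  proof (rule sum.cong[OF refl])
    fix k assume k: "k \<in> {..<n}"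
    have inv: "(k + n - (k + n - r) mod n) mod n = r" if "r < n" for r
      using that k by (cases "r \<le> k") (simp_all add: shift_mod)
    show "(\<Sum>i<n. c i * (w k * \<alpha>) ^ \<sigma> ^ (n - k + i)) =
          (\<Sum>r<n. (dickson_entry c r k * w k * \<alpha>) ^ \<sigma> ^ (n - r))"
    proof (rule sum.reindex_bij_witness[of _ "\<lambda>r. (k + n - r) mod n" "\<lambda>i. (k + n - i) mod n"])
      fix i assume i: "i \<in> {..<n}"
      let ?r = "(k + n - i) mod n"
      have r: "?r < n"
        using n_pos by simp
      have "(dickson_entry c ?r k * w k * \<alpha>) ^ \<sigma> ^ (n - ?r) =
            (c i ^ \<sigma> ^ ?r * (w k * \<alpha>)) ^ \<sigma> ^ (n - ?r)"
        using i inv[of i] by (simp add: dickson_entry_def mult.assoc)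
      also have "\<dots> = c i ^ \<sigma> ^ n * (w k * \<alpha>) ^ \<sigma> ^ (n - ?r)"
        using r by (subst power_mult_distrib) (simp add: power_\<sigma>_power_\<sigma>)
      also have "(w k * \<alpha>) ^ \<sigma> ^ (n - ?r) = (w k * \<alpha>) ^ \<sigma> ^ (n - k + i)"
      proof (rule power_\<sigma>_cong)
        show "[n - ?r = n - k + i] (mod n)"
        proof (cases "i \<le> k")
          case True
          then have "n - ?r = n - k + i"
            using i k by (simp add: shift_mod)
          then show ?thesis by simp
        next
          case False
          then have "n - k + i = n - ?r + n"
            using i k by (simp add: shift_mod)
          then show ?thesis by (simp add: cong_def)
        qed
      qed
      finally show "(dickson_entry c ?r k * w k * \<alpha>) ^ \<sigma> ^ (n - ?r) = c i * (w k * \<alpha>) ^ \<sigma> ^ (n - k + i)"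
        by (simp add: power_\<sigma>_n)
    qed (use n_pos inv in auto)
  qed
  also have "\<dots> = (\<Sum>r<n. \<Sum>k<n. (dickson_entry c r k * w k * \<alpha>) ^ \<sigma> ^ (n - r))"
    by (rule sum.swap)
  also have "\<dots> = vec_map (\<lambda>r. \<Sum>k<n. dickson_entry c r k * w k) \<alpha>"
    by (simp add: vec_map_def sum_power_\<sigma> sum_distrib_right)
  finally show ?thesis .
qed

lemma vec_map_inject:
  assumes eq: "\<And>\<alpha>. vec_map w \<alpha> = vec_map w' \<alpha>" and k: "k < n"
  shows "w k = w' k"
proof -
  have "(\<Sum>k<n. (w k - w' k) ^ \<sigma> ^ (n - k) * \<alpha> ^ \<sigma> ^ (n - k)) = 0" for \<alpha>
    using eq[of \<alpha>]
    by (simp add: vec_map_def power_mult_distrib diff_power_\<sigma> left_diff_distrib sum_subtractf)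
  from powers_\<sigma>_independent[OF this k] show ?thesis
    by simp
qed

lemma vec_map_power_\<sigma>: "vec_map w \<alpha> ^ \<sigma> = vec_map (\<lambda>k. w (Suc k mod n)) \<alpha>"
proof -
  have "vec_map w \<alpha> ^ \<sigma> = (\<Sum>k<n. (w k * \<alpha>) ^ \<sigma> ^ (n - k + 1))"
    using sum_power_\<sigma>[where A = "{..<n}" and m = 1]
    by (simp add: vec_map_def mult.commute flip: power_mult)
  also have "\<dots> = vec_map (\<lambda>k. w (Suc k mod n)) \<alpha>"
    unfolding vec_map_def
  proof (rule sum.reindex_bij_witness[of _ "\<lambda>k. Suc k mod n" "\<lambda>k. (k + n - 1) mod n"])
    fix k assume k: "k \<in> {..<n}"
    show *: "Suc ((k + n - 1) mod n) mod n = k"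
      using k n_pos by (simp add: mod_Suc_eq)
    show "(w (Suc ((k + n - 1) mod n) mod n) * \<alpha>) ^ \<sigma> ^ (n - (k + n - 1) mod n) =
          (w k * \<alpha>) ^ \<sigma> ^ (n - k + 1)"
      unfolding *
    proof (rule power_\<sigma>_cong)
      show "[n - (k + n - 1) mod n = n - k + 1] (mod n)"
      proof (cases k)
        case 0
        then have "(k + n - 1) mod n = n - 1"
          using n_pos by simp
        then have "n - (k + n - 1) mod n = 1"
          using n_pos by simp
        then show ?thesis
          using 0 by (simp add: cong_def mod_Suc)
      next
        case (Suc m)
        then have "n - (k + n - 1) mod n = n - k + 1"
          using k by (simp add: Suc_diff_Suc)
        then show ?thesis by simp
      qed
    qed
  next
    fix k assume k: "k \<in> {..<n}"
    show "(Suc k mod n + n - 1) mod n = k"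
      using k by (cases "Suc k = n") auto
  qed (use n_pos in auto)
  finally show ?thesis .
qed

text \<open>
  If the values are fixed, \<open>w\<close> and its cyclic shift define the same map and hence agree.  (The
  constant vectors correspond to the maps \<open>\<alpha> \<mapsto> Tr(b \<alpha>)\<close>.)
\<close>

lemma vec_map_into_fixpoints:
  assumes "\<And>\<alpha>. vec_map w \<alpha> ^ \<sigma> = vec_map w \<alpha>" and "j < n" and "k < n"
  shows "w j = w k"
proof -
  have step: "w (Suc k mod n) = w k" if "k < n" for k
    using vec_map_inject[of "\<lambda>k. w (Suc k mod n)" w k] assms(1) that by (simp add: vec_map_power_\<sigma>)
  have "w k = w 0" if "k < n" for k
    using that
  proof (induction k)
    case (Suc k)
    then show ?case using step[of k] by simp
  qed simp
  from this[OF assms(2)] this[OF assms(3)] show ?thesis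
    by simp
qed

lemma singular_minor_if_kernel:
  assumes c1: "linearized c 1 = 0" and ct: "linearized c t = 0" and t: "t ^ \<sigma> \<noteq> t"
    and r: "r < n" and k: "k < n"
  shows "det (mat_delete (mat n n (\<lambda>(r, k). dickson_entry c r k)) r k) = 0"
proof -
  define w where "w j = t ^ \<sigma> ^ j - t ^ \<sigma> ^ k" for j
  have "w k = 0"
    by (simp add: w_def)
  moreover have "\<exists>j<n. w j \<noteq> 0"
  proof (rule ccontr)
    assume "\<not> ?thesis"
    then have *: "t ^ \<sigma> ^ j = t ^ \<sigma> ^ k" if "j < n" for j
      using that by (auto simp: w_def)
    \<comment> \<open>All conjugates of \<open>t\<close> coincide; the index is reduced because \<open>n = 1\<close> is possible here.\<close>
    have "t = t ^ \<sigma> ^ (1 mod n)"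
      using *[of 0] *[of "1 mod n"] n_pos by simp
    also have "\<dots> = t ^ \<sigma>"
      using power_\<sigma>_cong[of "1 mod n" 1 t] by (simp add: cong_def)
    finally show False using t by simp
  qed
  moreover have "(\<Sum>j<n. dickson_entry c i j * w j) = 0" if i: "i < n" for i
  proof -
    have "(\<Sum>j<n. dickson_entry c i j * w j) =
        (\<Sum>j<n. dickson_entry c i j * t ^ \<sigma> ^ j) - (\<Sum>j<n. dickson_entry c i j * 1 ^ \<sigma> ^ j) * t ^ \<sigma> ^ k"
      by (simp add: w_def right_diff_distrib sum_subtractf sum_distrib_right)
    also have "\<dots> = 0"
      unfolding dickson_row_on_power_vector[OF i] c1 ct using \<sigma>_pos by (simp add: power_0_left)
    finally show ?thesis .
  qed
  ultimately show ?thesis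
    by (subst det_mat_delete_eq_0_iff[of _ n]) (use r k in \<open>auto intro!: exI[of _ w]\<close>)
qed

lemma nonsingular_minor_if_kernel_fixed:
  assumes c1: "linearized c 1 = 0" and fixed: "\<And>t. linearized c t = 0 \<Longrightarrow> t ^ \<sigma> = t"
    and r: "r < n" and k: "k < n"
  shows "det (mat_delete (mat n n (\<lambda>(r, k). dickson_entry c r k)) r k) \<noteq> 0"
proof
  assume "det (mat_delete (mat n n (\<lambda>(r, k). dickson_entry c r k)) r k) = 0"
  then obtain w l where w: "w k = 0" "l < n" "w l \<noteq> 0"
    and rows: "\<And>i. i < n \<Longrightarrow> i \<noteq> r \<Longrightarrow> (\<Sum>j<n. dickson_entry c i j * w j) = 0"
    by (subst (asm) det_mat_delete_eq_0_iff[of _ n]) (use r k in auto)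
  \<comment> \<open>The image of \<open>w\<close> is \<open>b\<close> times the unit vector at \<open>r\<close>, so the composite is a single summand.\<close>
  define b where "b = (\<Sum>j<n. dickson_entry c r j * w j)"
  have comp: "linearized c (vec_map w \<alpha>) = (b * \<alpha>) ^ \<sigma> ^ (n - r)" for \<alpha>
  proof -
    have "linearized c (vec_map w \<alpha>) =
        (\<Sum>i<n. if i = r then (b * \<alpha>) ^ \<sigma> ^ (n - r) else 0)"
      unfolding linearized_vec_map unfolding vec_map_def
      by (rule sum.cong) (use rows \<sigma>_pos in \<open>auto simp: b_def power_0_left\<close>)
    then show ?thesis
      using r by simp
  qed
  have "b = 0"
  proof (rule ccontr)
    assume b: "b \<noteq> 0"
    \<comment> \<open>The argument solves \<open>(b * \<alpha>) ^ \<sigma> ^ (n - r) = y\<close>, since the \<open>n\<close>-th iterate is the identity.\<close>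
    have "linearized c (vec_map w (y ^ \<sigma> ^ r / b)) = y" for y
      using r b by (simp add: comp power_\<sigma>_power_\<sigma> power_\<sigma>_n)
    then have "surj (linearized c)"
      by (rule surjI)
    then have "inj (linearized c)"
      using finite_UNIV_surj_inj[of "linearized c"] by simp
    moreover have "linearized c 0 = 0"
      using \<sigma>_pos by (simp add: linearized_def power_0_left)
    ultimately show False
      using c1 by (metis injD zero_neq_one)
  qed
  then have "vec_map w \<alpha> ^ \<sigma> = vec_map w \<alpha>" for \<alpha>
    using fixed comp[of \<alpha>] \<sigma>_pos by (simp add: power_0_left)
  then have "w l = w k"
    using w k by (intro vec_map_into_fixpoints)
  then show False
    using w by simp
qed

lemma dickson_mat_eq:
  assumes "1 < \<sigma>" and g: "g = (\<Sum>i<n. monom (c i) (\<sigma> ^ i))"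
  shows "dickson_mat \<sigma> n g = mat n n (\<lambda>(r, k). dickson_entry c r k)"
    and "poly g t = linearized c t"
proof -
  have "coeff g (\<sigma> ^ j) = c j" if "j < n" for j
  proof -
    have "coeff g (\<sigma> ^ j) = (\<Sum>i<n. if i = j then c i else 0)"
      unfolding g coeff_sum by (rule sum.cong) (use assms(1) in auto)
    then show ?thesis using that by simp
  qed
  then show "dickson_mat \<sigma> n g = mat n n (\<lambda>(r, k). dickson_entry c r k)"
    using n_pos by (auto simp: dickson_mat_def dickson_entry_def intro!: cong_mat)
  show "poly g t = linearized c t"
    by (simp add: g poly_sum poly_monom linearized_def)
qed

end


section \<open>Scatteredness and the kernels of the associated polynomials\<close>

text \<open>
  In a nontrivial relation \<open>\<alpha> + \<beta> u = 0\<close> the coefficient \<open>\<beta>\<close> cannot vanish, and \<open>u\<close> inherits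
  from \<open>\<beta>\<close> and \<open>\<beta> u\<close> the equation that characterizes \<open>K\<close>.
\<close>

lemma lin_dependent2_mult_iff:
  fixes K :: "'a::finite_field set"
  assumes K: "subfield K (ring_of_type_algebra :: 'a ring)" and x: "x \<noteq> 0"
  shows "lin_dependent2 K x (x * u) \<longleftrightarrow> u \<in> K"
proof
  have "subring K (ring_of_type_algebra :: 'a ring)"
    using K by (simp add: subfield.axioms subdomain.axioms subcring.axioms)
  then have one: "1 \<in> K"
    using subringE(3) by (fastforce simp: ring_of_type_algebra_def)
  have fixpoints: "K = {z. z ^ card K = z}"
    by (rule subfield_eq_power_fixpoints[OF K])
  have uminus: "- z \<in> K" if "z \<in> K" for z
    using uminus_closed_if_subring[OF \<open>subring K _\<close> that] .
  {
    assume "lin_dependent2 K x (x * u)"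
    then obtain \<alpha> \<beta> where ab: "\<alpha> \<in> K" "\<beta> \<in> K" "\<alpha> \<noteq> 0 \<or> \<beta> \<noteq> 0" "\<alpha> * x + \<beta> * (x * u) = 0"
      by (auto simp: lin_dependent2_def)
    from ab(4) have "(\<alpha> + \<beta> * u) * x = 0"
      by (simp add: algebra_simps)
    then have u: "\<beta> * u = - \<alpha>"
      using x by (simp add: eq_neg_iff_add_eq_0 add.commute)
    then have "\<beta> \<noteq> 0"
      using ab(3) by auto
    have "\<beta> * u \<in> K"
      using uminus[OF ab(1)] u by simp
    then have "\<beta> ^ card K * u ^ card K = \<beta> * u"
      using fixpoints by (metis (mono_tags) mem_Collect_eq power_mult_distrib)
    moreover have "\<beta> ^ card K = \<beta>"
      using fixpoints ab(2) by blast
    ultimately have "u ^ card K = u"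
      using \<open>\<beta> \<noteq> 0\<close> by simp
    then show "u \<in> K"
      using fixpoints by blast
  next
    assume "u \<in> K"
    then have "u * x + - 1 * (x * u) = 0" "- 1 \<in> K" "- 1 \<noteq> (0 :: 'a)"
      using uminus[OF one] by simp_all
    then show "lin_dependent2 K x (x * u)"
      using \<open>u \<in> K\<close> unfolding lin_dependent2_def by blast
  }
qed

theorem proposition2p2:
  fixes K :: "'a::finite_field set"
    and q n s \<sigma> :: nat
    and a :: "nat \<Rightarrow> 'a"
    and f :: "'a poly"
    and g :: "'a \<Rightarrow> 'a poly"
  assumes q: "primepow q"
    and n: "n \<ge> 3"
    and s: "s \<ge> 1" "gcd s n = 1"
    and \<sigma>: "\<sigma> = q ^ s"
    and card_field: "card (UNIV :: 'a set) = q ^ n"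
    and K: "subfield K (ring_of_type_algebra :: 'a ring)" "card K = q"
    and f: "f = (\<Sum>i=1..n-1. monom (a i) (\<sigma> ^ i))"
    and g: "\<And>x. g x = monom (- poly f x) 1 + (\<Sum>i=1..n-1. monom (a i * x ^ (\<sigma> ^ i)) (\<sigma> ^ i))"
  shows "(scattered K f \<longleftrightarrow>
            (\<forall>x. x \<noteq> 0 \<longrightarrow> (\<exists>r<n. \<exists>k<n. det (mat_delete (dickson_mat \<sigma> n (g x)) r k) \<noteq> 0)))
       \<and> (scattered K f \<longleftrightarrow>
            (\<forall>x. x \<noteq> 0 \<longrightarrow> (\<forall>r<n. \<forall>k<n. det (mat_delete (dickson_mat \<sigma> n (g x)) r k) \<noteq> 0)))"
proof -
  interpret frobenius_generator q n s \<sigma> "TYPE('a)"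
    using q n s(2) \<sigma> card_field by unfold_locales auto
  have "1 < \<sigma>"
    using one_less_power[OF q_gt_1, of s] s(1) by (simp add: \<sigma>)
  define c where "c x i = (if i = 0 then - poly f x else a i * x ^ \<sigma> ^ i)" for x i
  have "g x = (\<Sum>i<n. monom (c x i) (\<sigma> ^ i))" for x
  proof -
    have "{..<n} = insert 0 {1..n - 1}"
      using n by auto
    then show ?thesis
      by (simp add: g c_def)
  qed
  note dickson = dickson_mat_eq(1)[OF \<open>1 < \<sigma>\<close> this] and poly_g = dickson_mat_eq(2)[OF \<open>1 < \<sigma>\<close> this]
  have lin: "linearized (c x) t = - poly f x * t + poly f (x * t)" for x t
    unfolding poly_g[symmetric] by (rule poly_g_eq[OF f g])
  have K_iff: "u \<in> K \<longleftrightarrow> u ^ \<sigma> = u" for u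
    using subfield_eq_power_fixpoints[OF K(1)] by (auto simp: K(2) power_\<sigma>_fixpoint_iff)
  have K_kernel: "linearized (c x) u = 0" if "u ^ \<sigma> = u" for x u
  proof -
    have "u ^ \<sigma> ^ m = u" for m
      using that by (induction m) (simp_all add: power_mult)
    then have "poly f (x * u) = poly f x * u"
      by (simp add: f poly_sum poly_monom power_mult_distrib sum_distrib_right mult.assoc)
    then show ?thesis
      by (simp add: lin)
  qed
  have scattered_iff: "scattered K f \<longleftrightarrow>
    (\<forall>x. x \<noteq> 0 \<longrightarrow> (\<forall>u. linearized (c x) u = 0 \<longrightarrow> u ^ \<sigma> = u))" (is "_ \<longleftrightarrow> ?ker")
  proof -
    have pair: "x * poly f (x * u) - x * u * poly f x = 0 \<longleftrightarrow> linearized (c x) u = 0"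
      if "x \<noteq> 0" for x u
    proof -
      have "x * poly f (x * u) - x * u * poly f x = x * linearized (c x) u"
        by (simp add: lin algebra_simps)
      then show ?thesis using that by simp
    qed
    show ?thesis
    proof
      assume sc: "scattered K f"
      show ?ker
      proof (intro allI impI)
        fix x u assume "x \<noteq> 0" "linearized (c x) u = 0"
        then have "lin_dependent2 K x (x * u)"
          using sc pair unfolding scattered_def by blast
        then show "u ^ \<sigma> = u"
          using lin_dependent2_mult_iff[OF K(1) \<open>x \<noteq> 0\<close>] K_iff by blast
      qed
    next
      assume ker: ?ker
      show "scattered K f"
        unfolding scattered_def
      proof (intro allI)
        fix t x
        show "x * poly f t - t * poly f x = 0 \<longleftrightarrow> lin_dependent2 K x t"
        proof (cases "x = 0")
          \<comment> \<open>For \<open>x = 0\<close> both sides hold, so only the pairs \<open>(x, x u)\<close> with \<open>x \<noteq> 0\<close> matter.\<close>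
          case True
          have "poly f 0 = 0"
            using K_kernel[of 0 1] \<sigma>_pos lin[of 1 0] by (simp add: power_0_left)
          moreover have "1 \<in> K" "0 \<in> K"
            using \<sigma>_pos by (simp_all add: K_iff power_0_left)
          then have "lin_dependent2 K 0 t"
            unfolding lin_dependent2_def by (intro bexI[of _ 1] bexI[of _ 0]) auto
          ultimately show ?thesis
            using True by simp
        next
          case False
          then have "x * (t / x) = t" by simp
          then show ?thesis
            using pair[OF False, of "t / x"] ker K_kernel False K_iff
              lin_dependent2_mult_iff[OF K(1) False, of "t / x"] by metis
        qed
      qed
    qed
  qed
  have "linearized (c x) 1 = 0" for x
    by (rule K_kernel) simp
  then have "det (mat_delete (dickson_mat \<sigma> n (g x)) r k) \<noteq> 0 \<longleftrightarrow>
      (\<forall>u. linearized (c x) u = 0 \<longrightarrow> u ^ \<sigma> = u)" if "r < n" "k < n" for x r k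
    unfolding dickson
    using singular_minor_if_kernel nonsingular_minor_if_kernel_fixed that by metis
  then show ?thesis
    unfolding scattered_iff using n_pos by blast
qed

end
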